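(* Let $R$ be a quasiorder on a non-empty set $U$ and let $$\mathcal{M}=\{(\{x\}^{\blacktriangle c},U)\mid x\in U,\ |R(x)|\geq 2\}\cup\{(\{x\}^{\vartriangle\blacktriangle c},\{x\}^{\vartriangle c})\mid x\in U\}.$$ Then $\mathcal{M}$ is the set of completely meet-irreducible elements of the complete lattice $\mathcal{RS}$. Any nonunit element of $\mathcal{RS}$ is a meet of some completely meet-irreducible elements of $\mathcal{M}$.
   Context: A quasiorder is a reflexive and transitive binary relation. For $x\in U$, $R(x)=\{y\in U\mid x\,R\,y\}$ and $R^{-1}(x)=\{y\in U\mid y\,R\,x\}$. For $X\subseteq U$, $X^{\blacktriangledown}=\{x\in U\mid R(x)\subseteq X\}$, $X^{\blacktriangle}=\{x\in U\mid R(x)\cap X\neq\emptyset\}$, $X^{\vartriangle}=\{x\in U\mid R^{-1}(x)\cap X\neq\emptyset\}$, and $X^c=U\setminus X$. Stacked superscripts are applied from left to right, e.g. $\{x\}^{\vartriangle\blacktriangle c}=((\{x\}^{\vartriangle})^{\blacktriangle})^c$. The rough set of $X$ is $\mathcal{A}(X)=(X^{\blacktriangledown},X^{\blacktriangle})$, $RS=\{\mathcal{A}(X)\mid X\subseteq U\}$, and $\mathcal{RS}=(RS,\leq)$ with $\leq$ the coordinatewise inclusion order on pairs of sets; for a quasiorder $R$ on a non-empty set this is a complete lattice with coordinatewise unions and intersections as joins and meets and with greatest element (unit) $(U,U)$. The completely meet-irreducible elements of a complete lattice $L$ are the completely join-irreducible elements of its dual; that is, $x$ is completely meet-irreducible if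 for every subset $S$ of $L$, $x=\bigwedge S$ implies $x\in S$. (Equivalently, $\mathcal{M}=\{\mathcal{A}(\{x\}^c)\mid x\in U,\ |R(x)|\geq 2\}\cup\{\mathcal{A}(\{x\}^{\vartriangle c})\mid x\in U\}$.) *)

theory Defs
  imports "HOL-Algebra.Complete_Lattice"
begin

text \<open>
  A quasiorder \<open>R\<close> on \<open>U\<close> is the library's \<open>preorder_on U R\<close>. The neighbourhoods are
  \<open>R(x) = R `` {x}\<close> and \<open>R\<^sup>-\<^sup>1(x) = R\<inverse> `` {x}\<close>.
\<close>

definition lower_approx :: "'a set \<Rightarrow> 'a rel \<Rightarrow> 'a set \<Rightarrow> 'a set" where
  "lower_approx U R X = {x \<in> U. R `` {x} \<subseteq> X}"

definition upper_approx :: "'a set \<Rightarrow> 'a rel \<Rightarrow> 'a set \<Rightarrow> 'a set" where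
  "upper_approx U R X = {x \<in> U. R `` {x} \<inter> X \<noteq> {}}"

text \<open>The operator written with the white triangle pointing up.\<close>

definition inv_upper_approx :: "'a set \<Rightarrow> 'a rel \<Rightarrow> 'a set \<Rightarrow> 'a set" where
  "inv_upper_approx U R X = {x \<in> U. R\<inverse> `` {x} \<inter> X \<noteq> {}}"

definition rough_set :: "'a set \<Rightarrow> 'a rel \<Rightarrow> 'a set \<Rightarrow> 'a set \<times> 'a set" where
  "rough_set U R X = (lower_approx U R X, upper_approx U R X)"

definition RS :: "'a set \<Rightarrow> 'a rel \<Rightarrow> ('a set \<times> 'a set) gorder" where
  "RS U R = \<lparr>carrier = {rough_set U R X | X. X \<subseteq> U}, eq = (=),
             le = (\<lambda>p q. fst p \<subseteq> fst q \<and> snd p \<subseteq> snd q)\<rparr>"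

text \<open>
  The meet is expressed as a relation, since \<open>Lattice.inf\<close> selects an arbitrary greatest lower
  bound with Hilbert's choice and is unspecified where none exists. In a complete lattice whose
  \<open>eq\<close> is equality, and for \<open>S \<subseteq> carrier L\<close>, it says exactly \<open>x = \<Sqinter>\<^bsub>L\<^esub>S\<close>. The set \<open>S\<close>
  may be empty, in which case the meet is the greatest element.
\<close>

definition is_meet :: "('a, 'b) gorder_scheme \<Rightarrow> 'a \<Rightarrow> 'a set \<Rightarrow> bool" where
  "is_meet L x S \<longleftrightarrow> greatest L x (Lower L S)"

definition completely_meet_irreducible :: "('a, 'b) gorder_scheme \<Rightarrow> 'a \<Rightarrow> bool" where
  "completely_meet_irreducible L x \<longleftrightarrow>
     x \<in> carrier L \<and> (\<forall>S \<subseteq> carrier L. is_meet L x S \<longrightarrow> x \<in> S)"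

text \<open>In the first family, \<open>|R(x)| \<ge> 2\<close> includes infinite \<open>R(x)\<close>, for which \<open>card\<close> is \<open>0\<close>.\<close>

definition RS_meet_family :: "'a set \<Rightarrow> 'a rel \<Rightarrow> ('a set \<times> 'a set) set" where
  "RS_meet_family U R =
     {(U - upper_approx U R {x}, U) | x.
        x \<in> U \<and> (infinite (R `` {x}) \<or> card (R `` {x}) \<ge> 2)} \<union>
     {(U - upper_approx U R (inv_upper_approx U R {x}), U - inv_upper_approx U R {x}) | x. x \<in> U}"

end

theory Submission
  imports Defs
begin

text \<open>
  Write \<open>x \<le> y\<close> for \<open>(x, y) \<in> R\<close>, so that \<open>R(x)\<close> is the up-set generated by \<open>x\<close>. The two
  families are then the rough sets of the sets \<open>U - {x}\<close>, for \<open>x\<close> with \<open>R(x) \<noteq> {x}\<close>, and of the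
  sets \<open>U - R(x)\<close>, for arbitrary \<open>x\<close>.

  \<^emph>\<open>The family is meet-dense.\<close> The rough set of \<open>U - R(x)\<close> is the largest one whose upper
  component avoids \<open>x\<close>, so these elements determine the upper component of any rough set. The
  lower component of the rough set of \<open>X\<close> fails to contain \<open>y\<close> because of some \<open>z \<ge> y\<close> outside
  \<open>X\<close>. If \<open>R(z)\<close> has a second point, the rough set of \<open>U - {z}\<close> witnesses this failure; if
  \<open>R(z) = {z}\<close>, then \<open>z\<close> is missing from the upper component as well, and the other family takes
  care of it. This is \<open>rough_set_is_meet_of_family\<close>. A completely meet-irreducible element, being
  a meet of members of the family, is therefore itself a member.

  \<^emph>\<open>Every member is completely meet-irreducible.\<close> It suffices to exhibit, for each member \<open>p\<close>,
  a rough set that is not below \<open>p\<close> but is below every rough set strictly above \<open>p\<close>: a family of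
  elements above \<open>p\<close> that omits \<open>p\<close> then has this element as a lower bound, so \<open>p\<close> is not its
  meet (\<open>completely_meet_irreducibleI\<close>). In this way meets of rough sets never have to be
  computed. For the rough set of \<open>U - {x}\<close>, and for that of \<open>U - R(x)\<close> when \<open>R(x) = {x}\<close>, the
  witness comes from \<open>{y. \<not> y \<le> x} \<union> R(x)\<close>; for the rough set of \<open>U - R(x)\<close> with \<open>R(x) \<noteq> {x}\<close>
  it comes from \<open>(U - R(x)) \<union> {x}\<close>.
\<close>

section \<open>Completely meet-irreducible elements of ordered structures\<close>

text \<open>
  The element \<open>c\<close> plays the role of the unique upper cover of \<open>p\<close>. If \<open>p\<close> were the meet of a set
  not containing \<open>p\<close>, then \<open>c\<close> would be a lower bound of that set and hence lie below \<open>p\<close>.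
\<close>

lemma completely_meet_irreducibleI:
  assumes "p \<in> carrier L" and "c \<in> carrier L" and "\<not> c \<sqsubseteq>\<^bsub>L\<^esub> p"
    and "\<And>q. q \<in> carrier L \<Longrightarrow> p \<sqsubseteq>\<^bsub>L\<^esub> q \<Longrightarrow> q \<noteq> p \<Longrightarrow> c \<sqsubseteq>\<^bsub>L\<^esub> q"
  shows "completely_meet_irreducible L p"
  using assms unfolding completely_meet_irreducible_def is_meet_def greatest_def Lower_def
  by blast

lemma completely_meet_irreducible_in_meet_dense:
  assumes "completely_meet_irreducible L p" and "M \<subseteq> carrier L"
    and "\<exists>S \<subseteq> M. is_meet L p S"
  shows "p \<in> M"
  using assms unfolding completely_meet_irreducible_def by blast

section \<open>Rough sets of a quasiorder\<close>

lemma carrier_RS: "carrier (RS U R) = {rough_set U R X | X. X \<subseteq> U}"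
  by (simp add: RS_def)

lemma rough_set_in_RS: "X \<subseteq> U \<Longrightarrow> rough_set U R X \<in> carrier (RS U R)"
  by (auto simp: carrier_RS)

lemma le_RS: "p \<sqsubseteq>\<^bsub>RS U R\<^esub> q \<longleftrightarrow> fst p \<subseteq> fst q \<and> snd p \<subseteq> snd q"
  by (simp add: RS_def)

lemma rough_set_sel [simp]:
  "fst (rough_set U R X) = lower_approx U R X"
  "snd (rough_set U R X) = upper_approx U R X"
  by (simp_all add: rough_set_def)

lemma rough_set_mono: "X \<subseteq> Y \<Longrightarrow> rough_set U R X \<sqsubseteq>\<^bsub>RS U R\<^esub> rough_set U R Y"
  by (auto simp: le_RS lower_approx_def upper_approx_def)

lemma mem_lower_approx: "y \<in> lower_approx U R X \<longleftrightarrow> y \<in> U \<and> (\<forall>z. (y, z) \<in> R \<longrightarrow> z \<in> X)"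
  by (auto simp: lower_approx_def)

lemma mem_upper_approx: "y \<in> upper_approx U R X \<longleftrightarrow> y \<in> U \<and> (\<exists>z. (y, z) \<in> R \<and> z \<in> X)"
  by (auto simp: upper_approx_def)

locale quasiorder =
  fixes U :: "'a set" and R :: "'a rel"
  assumes preorder: "preorder_on U R"
begin

lemma R_refl: "x \<in> U \<Longrightarrow> (x, x) \<in> R"
  using preorder by (auto simp: preorder_on_def refl_on_def)

lemma R_trans: "(x, y) \<in> R \<Longrightarrow> (y, z) \<in> R \<Longrightarrow> (x, z) \<in> R"
  using preorder by (auto simp: preorder_on_def dest: transD)

lemma R_field: "(x, y) \<in> R \<Longrightarrow> x \<in> U \<and> y \<in> U"
  using preorder by (auto simp: preorder_on_def refl_on_def)

lemma lower_approx_subset: "lower_approx U R X \<subseteq> X"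
  by (auto simp: mem_lower_approx R_refl)

lemma upper_approx_down_closed:
  "(y, x) \<in> R \<Longrightarrow> x \<in> upper_approx U R X \<Longrightarrow> y \<in> upper_approx U R X"
  by (meson mem_upper_approx R_field R_trans)

lemma inv_upper_approx_singleton: "x \<in> U \<Longrightarrow> inv_upper_approx U R {x} = R `` {x}"
  by (auto simp: inv_upper_approx_def dest: R_field)

lemma two_points_iff:
  assumes "x \<in> U"
  shows "infinite (R `` {x}) \<or> 2 \<le> card (R `` {x}) \<longleftrightarrow> R `` {x} \<noteq> {x}"
proof -
  have x: "x \<in> R `` {x}"
    using R_refl[OF assms] by simp
  have "card (R `` {x}) \<noteq> 0" if "finite (R `` {x})"
    using that x by auto
  moreover have "card (R `` {x}) = 1 \<longleftrightarrow> R `` {x} = {x}"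
    using x by (metis One_nat_def card_1_singleton_iff singletonD)
  moreover have "R `` {x} \<noteq> {x}" if "infinite (R `` {x})"
    using that by (metis finite.emptyI finite.insertI)
  ultimately show ?thesis
    by linarith
qed

text \<open>
  The upper component is all of \<open>U\<close> because a point \<open>y\<close> outside it would satisfy \<open>R(y) = {x}\<close>,
  forcing \<open>y = x\<close>.
\<close>

lemma rough_set_Compl_point:
  assumes "x \<in> U" and "R `` {x} \<noteq> {x}"
  shows "rough_set U R (U - {x}) = (U - upper_approx U R {x}, U)"
proof -
  have "lower_approx U R (U - {x}) = U - upper_approx U R {x}"
    by (auto simp: mem_lower_approx mem_upper_approx dest: R_field)
  moreover have "y \<in> upper_approx U R (U - {x})" if "y \<in> U" for y
  proof (cases "y = x")
    case True
    with assms R_refl[OF assms(1)] show ?thesis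
      by (auto simp: mem_upper_approx dest: R_field)
  next
    case False
    with that R_refl[OF that] show ?thesis
      by (auto simp: mem_upper_approx)
  qed
  then have "upper_approx U R (U - {x}) = U"
    by (auto simp: mem_upper_approx)
  ultimately show ?thesis
    by (simp add: rough_set_def)
qed

lemma rough_set_Compl_up:
  assumes "x \<in> U"
  shows "rough_set U R (U - R `` {x}) = (U - upper_approx U R (R `` {x}), U - R `` {x})"
proof -
  have "lower_approx U R (U - R `` {x}) = U - upper_approx U R (R `` {x})"
    by (auto simp: mem_lower_approx mem_upper_approx dest: R_field)
  moreover have "upper_approx U R (U - R `` {x}) = U - R `` {x}"
    using R_refl by (auto simp: mem_upper_approx intro: R_trans)
  ultimately show ?thesis
    by (simp add: rough_set_def)
qed

lemma RS_meet_family_eq: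
  "RS_meet_family U R =
     {rough_set U R (U - {x}) | x. x \<in> U \<and> R `` {x} \<noteq> {x}} \<union>
     {rough_set U R (U - R `` {x}) | x. x \<in> U}"
proof -
  have "{(U - upper_approx U R {x}, U) | x.
          x \<in> U \<and> (infinite (R `` {x}) \<or> 2 \<le> card (R `` {x}))} =
        {rough_set U R (U - {x}) | x. x \<in> U \<and> R `` {x} \<noteq> {x}}"
    using two_points_iff rough_set_Compl_point by (metis (no_types, lifting))
  moreover have "{(U - upper_approx U R (inv_upper_approx U R {x}),
                   U - inv_upper_approx U R {x}) | x. x \<in> U} =
                 {rough_set U R (U - R `` {x}) | x. x \<in> U}"
    using inv_upper_approx_singleton rough_set_Compl_up by (metis (no_types, lifting))
  ultimately show ?thesis
    by (simp add: RS_meet_family_def)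
qed

lemma RS_meet_family_subset: "RS_meet_family U R \<subseteq> carrier (RS U R)"
  by (auto simp: RS_meet_family_eq carrier_RS)

section \<open>Meet-density of the family\<close>

text \<open>
  A rough set that lies below all members of the family above the rough set of \<open>X\<close> is compared
  with the latter one point at a time: each point missing from a component of the rough set of
  \<open>X\<close> is excluded by one member.
\<close>

lemma rough_set_is_meet_of_family:
  assumes "X \<subseteq> U"
  defines "S \<equiv> {q \<in> RS_meet_family U R. rough_set U R X \<sqsubseteq>\<^bsub>RS U R\<^esub> q}"
  shows "is_meet (RS U R) (rough_set U R X) S"
proof -
  have below: "rough_set U R Y \<sqsubseteq>\<^bsub>RS U R\<^esub> rough_set U R X"
    if Y: "\<And>q. q \<in> S \<Longrightarrow> rough_set U R Y \<sqsubseteq>\<^bsub>RS U R\<^esub> q" for Y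
  proof -
    have up: "y \<in> upper_approx U R X" if y: "y \<in> upper_approx U R Y" for y
    proof (rule ccontr)
      assume "y \<notin> upper_approx U R X"
      moreover have "y \<in> U"
        using y by (simp add: mem_upper_approx)
      ultimately have "X \<subseteq> U - R `` {y}"
        using \<open>X \<subseteq> U\<close> by (auto simp: mem_upper_approx)
      then have "rough_set U R (U - R `` {y}) \<in> S"
        using \<open>y \<in> U\<close> by (auto simp: S_def RS_meet_family_eq intro: rough_set_mono)
      from Y[OF this] have "upper_approx U R Y \<subseteq> U - R `` {y}"
        using rough_set_Compl_up[OF \<open>y \<in> U\<close>] by (simp add: le_RS)
      with y show False
        using R_refl[OF \<open>y \<in> U\<close>] by auto
    qed
    have low: "y \<in> lower_approx U R X" if y: "y \<in> lower_approx U R Y" for y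
    proof (rule ccontr)
      assume "y \<notin> lower_approx U R X"
      then obtain z where z: "(y, z) \<in> R" "z \<notin> X"
        using y by (auto simp: mem_lower_approx)
      have "z \<in> U"
        using z R_field by blast
      show False
      proof (cases "R `` {z} = {z}")
        case True
        \<comment> \<open>For a maximal point \<open>z\<close>, membership in a set and in its upper approximation agree.\<close>
        have "z \<in> upper_approx U R Y"
          using y z \<open>z \<in> U\<close> by (auto simp: mem_lower_approx mem_upper_approx intro: R_refl)
        then have "z \<in> upper_approx U R X"
          by (rule up)
        with True z show False
          by (auto simp: mem_upper_approx)
      next
        case False
        have "X \<subseteq> U - {z}"
          using \<open>X \<subseteq> U\<close> z by blast
        then have "rough_set U R (U - {z}) \<in> S"
          using \<open>z \<in> U\<close> False by (auto simp: S_def RS_meet_family_eq intro: rough_set_mono)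
        from Y[OF this] have "lower_approx U R Y \<subseteq> U - upper_approx U R {z}"
          using rough_set_Compl_point[OF \<open>z \<in> U\<close> False] by (simp add: le_RS)
        with y z show False
          by (auto simp: mem_upper_approx dest: R_field)
      qed
    qed
    from up low show ?thesis
      by (auto simp: le_RS)
  qed
  have "S \<subseteq> carrier (RS U R)"
    using RS_meet_family_subset by (auto simp: S_def)
  moreover have "rough_set U R X \<in> Lower (RS U R) S"
    using \<open>X \<subseteq> U\<close> by (simp add: Lower_def S_def rough_set_in_RS)
  moreover have "r \<sqsubseteq>\<^bsub>RS U R\<^esub> rough_set U R X" if r: "r \<in> Lower (RS U R) S" for r
  proof -
    obtain Y where Y: "r = rough_set U R Y"
      using r unfolding Lower_def carrier_RS by blast
    have "r \<sqsubseteq>\<^bsub>RS U R\<^esub> q" if "q \<in> S" for q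
      using r \<open>S \<subseteq> carrier (RS U R)\<close> that
      unfolding Lower_def by blast
    then show ?thesis
      unfolding Y by (rule below)
  qed
  ultimately show ?thesis
    unfolding is_meet_def greatest_def by (auto simp: Lower_def)
qed

section \<open>Complete meet-irreducibility of the members\<close>

text \<open>
  The set \<open>{y. \<not> y \<le> x} \<union> R(x)\<close> is contained in every \<open>Z\<close> whose lower approximation contains
  all \<open>y\<close> with \<open>\<not> y \<le> x\<close> and which includes \<open>R(x)\<close>; its rough set is therefore the least
  among the rough sets of such \<open>Z\<close>.
\<close>

definition down_compl_up :: "'a \<Rightarrow> 'a set" where
  "down_compl_up x = (U - R\<inverse> `` {x}) \<union> R `` {x}"

lemma down_compl_up_subset: "down_compl_up x \<subseteq> U"
  by (auto simp: down_compl_up_def dest: R_field)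

lemma upper_approx_down_compl_up:
  assumes "x \<in> U"
  shows "upper_approx U R (down_compl_up x) = U"
proof -
  have "y \<in> upper_approx U R (down_compl_up x)" if "y \<in> U" for y
  proof (cases "(y, x) \<in> R")
    case True
    with that R_refl[OF assms] show ?thesis
      by (auto simp: mem_upper_approx down_compl_up_def)
  next
    case False
    with that R_refl[OF that] show ?thesis
      by (auto simp: mem_upper_approx down_compl_up_def)
  qed
  then show ?thesis
    by (auto simp: mem_upper_approx)
qed

lemma mem_lower_approx_down_compl_up:
  assumes "x \<in> U"
  shows "x \<in> lower_approx U R (down_compl_up x)"
  using assms by (auto simp: mem_lower_approx down_compl_up_def)

lemma rough_set_down_compl_up_least:
  assumes "U - R\<inverse> `` {x} \<subseteq> lower_approx U R Z" and "R `` {x} \<subseteq> Z"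
  shows "rough_set U R (down_compl_up x) \<sqsubseteq>\<^bsub>RS U R\<^esub> rough_set U R Z"
  using assms lower_approx_subset[of Z]
  by (intro rough_set_mono) (auto simp: down_compl_up_def)

text \<open>
  A rough set strictly above that of \<open>U - {x}\<close> can only gain points in the lower component, since
  the upper component is already \<open>U\<close>. Such a new point \<open>y\<close> satisfies \<open>y \<le> x\<close>, and then
  \<open>R(x) \<subseteq> R(y) \<subseteq> Z\<close>, where \<open>Z\<close> is the defining set of the larger rough set.
\<close>

lemma completely_meet_irreducible_Compl_point:
  assumes x: "x \<in> U" and two: "R `` {x} \<noteq> {x}"
  shows "completely_meet_irreducible (RS U R) (rough_set U R (U - {x}))"
proof (rule completely_meet_irreducibleI)
  show "rough_set U R (U - {x}) \<in> carrier (RS U R)"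
    by (auto intro: rough_set_in_RS)
  show "rough_set U R (down_compl_up x) \<in> carrier (RS U R)"
    by (intro rough_set_in_RS down_compl_up_subset)
  have "x \<notin> lower_approx U R (U - {x})"
    using x R_refl by (auto simp: mem_lower_approx)
  then show "\<not> rough_set U R (down_compl_up x) \<sqsubseteq>\<^bsub>RS U R\<^esub> rough_set U R (U - {x})"
    using mem_lower_approx_down_compl_up[OF x] by (auto simp: le_RS)
  fix q
  assume "q \<in> carrier (RS U R)" and le: "rough_set U R (U - {x}) \<sqsubseteq>\<^bsub>RS U R\<^esub> q"
    and ne: "q \<noteq> rough_set U R (U - {x})"
  then obtain Z where Z: "Z \<subseteq> U" "q = rough_set U R Z"
    by (auto simp: carrier_RS)
  have eq: "upper_approx U R {x} = R\<inverse> `` {x}"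
    by (auto simp: mem_upper_approx dest: R_field)
  have low: "U - R\<inverse> `` {x} \<subseteq> lower_approx U R Z" and up: "U \<subseteq> upper_approx U R Z"
    using le by (simp_all add: Z le_RS rough_set_Compl_point[OF x two] eq)
  from up have "upper_approx U R Z = U"
    by (auto simp: mem_upper_approx)
  with ne have "lower_approx U R Z \<noteq> U - R\<inverse> `` {x}"
    unfolding Z rough_set_Compl_point[OF x two] eq by (simp add: rough_set_def)
  moreover have "lower_approx U R Z \<subseteq> U"
    using lower_approx_subset Z(1) by blast
  ultimately obtain y where y: "y \<in> lower_approx U R Z" "(y, x) \<in> R"
    using low by blast
  then have "R `` {x} \<subseteq> Z"
    by (auto simp: mem_lower_approx intro: R_trans)
  with low show "rough_set U R (down_compl_up x) \<sqsubseteq>\<^bsub>RS U R\<^esub> q"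
    by (simp add: Z rough_set_down_compl_up_least)
qed

text \<open>
  If \<open>x\<close> were missing from the upper component, then \<open>Z\<close> would avoid \<open>R(x)\<close>, that is,
  lie in \<open>U - R(x)\<close>.
\<close>

lemma rough_set_above_Compl_up:
  assumes x: "x \<in> U" and "Z \<subseteq> U"
    and le: "rough_set U R (U - R `` {x}) \<sqsubseteq>\<^bsub>RS U R\<^esub> rough_set U R Z"
    and ne: "rough_set U R Z \<noteq> rough_set U R (U - R `` {x})"
  shows "x \<in> upper_approx U R Z"
proof (rule ccontr)
  assume "x \<notin> upper_approx U R Z"
  then have "Z \<subseteq> U - R `` {x}"
    using x \<open>Z \<subseteq> U\<close> by (auto simp: mem_upper_approx)
  then have "rough_set U R Z \<sqsubseteq>\<^bsub>RS U R\<^esub> rough_set U R (U - R `` {x})"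
    by (rule rough_set_mono)
  with le ne show False
    by (auto simp: le_RS intro: prod_eqI)
qed

text \<open>
  Adding \<open>x\<close> to \<open>U - R(x)\<close> puts \<open>x\<close> into the upper component. When \<open>R(x)\<close> has a second point
  the lower component stays the same, so this is the cheapest way to do so. When \<open>R(x) = {x}\<close>
  the enlarged set is all of \<open>U\<close>, which may be too big; but then any set with \<open>x\<close> in its upper
  approximation contains \<open>x\<close> itself, and the same witness as for \<open>U - {x}\<close> works.
\<close>

lemma completely_meet_irreducible_Compl_up:
  assumes x: "x \<in> U"
  shows "completely_meet_irreducible (RS U R) (rough_set U R (U - R `` {x}))"
proof -
  let ?p = "rough_set U R (U - R `` {x})"
  have p: "?p \<in> carrier (RS U R)"
    by (auto intro: rough_set_in_RS)
  have x_notin: "x \<notin> upper_approx U R (U - R `` {x})"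
    by (auto simp: mem_upper_approx)
  have above: "U - upper_approx U R (R `` {x}) \<subseteq> lower_approx U R Z"
    "U - R `` {x} \<subseteq> upper_approx U R Z"
    if "?p \<sqsubseteq>\<^bsub>RS U R\<^esub> rough_set U R Z" for Z
    using that by (simp_all add: le_RS rough_set_Compl_up[OF x])
  show ?thesis
  proof (cases "R `` {x} = {x}")
    case True
    show ?thesis
    proof (rule completely_meet_irreducibleI[OF p])
      show "rough_set U R (down_compl_up x) \<in> carrier (RS U R)"
        by (intro rough_set_in_RS down_compl_up_subset)
      show "\<not> rough_set U R (down_compl_up x) \<sqsubseteq>\<^bsub>RS U R\<^esub> ?p"
        using x x_notin upper_approx_down_compl_up[OF x] by (auto simp: le_RS)
      fix q
      assume "q \<in> carrier (RS U R)" and le: "?p \<sqsubseteq>\<^bsub>RS U R\<^esub> q" and ne: "q \<noteq> ?p"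
      then obtain Z where Z: "Z \<subseteq> U" "q = rough_set U R Z"
        by (auto simp: carrier_RS)
      have "x \<in> upper_approx U R Z"
        using rough_set_above_Compl_up x Z le ne by blast
      then have "R `` {x} \<subseteq> Z"
        using True by (auto simp: mem_upper_approx)
      moreover have "U - R\<inverse> `` {x} \<subseteq> lower_approx U R Z"
        using above(1)[of Z] le True by (auto simp: Z mem_upper_approx)
      ultimately show "rough_set U R (down_compl_up x) \<sqsubseteq>\<^bsub>RS U R\<^esub> q"
        by (simp add: Z rough_set_down_compl_up_least)
    qed
  next
    case False
    let ?W = "(U - R `` {x}) \<union> {x}"
    obtain w where w: "(x, w) \<in> R" "w \<noteq> x"
      using False R_refl[OF x] by auto
    have low: "lower_approx U R ?W \<subseteq> U - upper_approx U R (R `` {x})"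
    proof
      fix y
      assume y: "y \<in> lower_approx U R ?W"
      have "(y, z) \<notin> R" if xz: "(x, z) \<in> R" for z
      proof
        assume yz: "(y, z) \<in> R"
        \<comment> \<open>The only common point of \<open>?W\<close> and \<open>R(x)\<close> is \<open>x\<close>, but with \<open>x\<close> also \<open>w\<close> is in \<open>R(y)\<close>.\<close>
        with y xz have "z = x"
          by (auto simp: mem_lower_approx)
        with yz w have "(y, w) \<in> R"
          by (blast intro: R_trans)
        with y w show False
          by (auto simp: mem_lower_approx)
      qed
      with y show "y \<in> U - upper_approx U R (R `` {x})"
        by (auto simp: mem_lower_approx mem_upper_approx)
    qed
    have up: "upper_approx U R ?W \<subseteq> (U - R `` {x}) \<union> R\<inverse> `` {x}"
      by (auto simp: mem_upper_approx intro: R_trans)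
    show ?thesis
    proof (rule completely_meet_irreducibleI[OF p])
      show "rough_set U R ?W \<in> carrier (RS U R)"
        using x by (intro rough_set_in_RS) auto
      have "x \<in> upper_approx U R ?W"
        using x R_refl by (auto simp: mem_upper_approx)
      then show "\<not> rough_set U R ?W \<sqsubseteq>\<^bsub>RS U R\<^esub> ?p"
        using x_notin by (auto simp: le_RS)
      fix q
      assume "q \<in> carrier (RS U R)" and le: "?p \<sqsubseteq>\<^bsub>RS U R\<^esub> q" and ne: "q \<noteq> ?p"
      then obtain Z where Z: "Z \<subseteq> U" "q = rough_set U R Z"
        by (auto simp: carrier_RS)
      have "x \<in> upper_approx U R Z"
        using rough_set_above_Compl_up x Z le ne by blast
      then have "R\<inverse> `` {x} \<subseteq> upper_approx U R Z"
        by (auto intro: upper_approx_down_closed)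
      then show "rough_set U R ?W \<sqsubseteq>\<^bsub>RS U R\<^esub> q"
        using low up above[of Z] le unfolding Z le_RS rough_set_sel by blast
    qed
  qed
qed

lemma RS_meet_family_completely_meet_irreducible:
  "p \<in> RS_meet_family U R \<Longrightarrow> completely_meet_irreducible (RS U R) p"
  using completely_meet_irreducible_Compl_point completely_meet_irreducible_Compl_up
  by (auto simp: RS_meet_family_eq)

lemma RS_meet_family_meet_dense:
  assumes "p \<in> carrier (RS U R)"
  shows "\<exists>S \<subseteq> RS_meet_family U R. is_meet (RS U R) p S"
proof -
  obtain X where X: "X \<subseteq> U" "p = rough_set U R X"
    using assms by (auto simp: carrier_RS)
  from rough_set_is_meet_of_family[OF X(1)] show ?thesis
    unfolding X(2) by (intro exI conjI) auto
qed

end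

section \<open>The completely meet-irreducible rough sets\<close>

theorem corollary5p3:
  fixes U :: "'a set" and R :: "'a rel"
  assumes "U \<noteq> {}" and "preorder_on U R"
  shows "RS_meet_family U R = {p. completely_meet_irreducible (RS U R) p} \<and>
         (\<forall>p \<in> carrier (RS U R). p \<noteq> \<top>\<^bsub>RS U R\<^esub> \<longrightarrow>
            (\<exists>S \<subseteq> RS_meet_family U R. is_meet (RS U R) p S))"
proof -
  interpret quasiorder U R
    using assms(2) by unfold_locales
  have "p \<in> RS_meet_family U R" if p: "completely_meet_irreducible (RS U R) p" for p
  proof (rule completely_meet_irreducible_in_meet_dense[OF p RS_meet_family_subset])
    show "\<exists>S \<subseteq> RS_meet_family U R. is_meet (RS U R) p S"
      using p by (intro RS_meet_family_meet_dense) (simp add: completely_meet_irreducible_def)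
  qed
  then show ?thesis
    using RS_meet_family_completely_meet_irreducible RS_meet_family_meet_dense by blast
qed

end
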